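(* Let $A$ be an $n\times n$ symmetric positive definite matrix, $\mathbf{x}\sim\mathcal{N}(\boldsymbol\mu,\Sigma)$ in $\mathbb{R}^n$ with $\Sigma$ positive definite, and let $\lambda_i,b_i$ ($1\le i\le n$) and $c_k$ ($k\ge 0$) be as defined in the context. Let $0<\rho<\min_i\lambda_i$ and set $$m(\rho)=\prod_{i=1}^n\lambda_i^{-1/2}\,\exp\left(-\frac12\sum_{i=1}^n\frac{b_i^2\lambda_i}{\lambda_i+\rho}\right)\prod_{i=1}^n\left(1-\frac{\rho}{\lambda_i}\right)^{-1/2}.$$ For $y>0$ and $N\ge 0$ define the truncation errors of the series for the pdf and the cdf of $\mathbf{x}^TA\mathbf{x}$ by $$e(N)=\left|\sum_{k=N+1}^\infty(-1)^kc_k\frac{y^{\frac n2+k-1}}{\Gamma(\frac n2+k)}\right|,\qquad E(N)=\left|\sum_{k=N+1}^\infty(-1)^kc_k\frac{y^{\frac n2+k}}{\Gamma(\frac n2+k+1)}\right|.$$ Then $$e(N)\le \frac{m(\rho)}{\Gamma(\frac n2)\,N!}\left(\frac y2\right)^{\frac n2-1}\left(\frac{y}{2\rho}\right)^{N+1}\exp\left(\frac{y}{2\rho}\right)$$ and $$E(N)\le \frac{m(\rho)}{\Gamma(\frac n2)\,(N+1)!}\left(\frac y2\right)^{\frac n2}\left(\frac{y}{2\rho}\right)^{N+1}\exp\left(\frac{y}{2\rho}\right).$$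
   Context: $\Gamma$ is the gamma function. Let $\lambda_1,\dots,\lambda_n>0$ be the eigenvalues of $\Sigma^{1/2}A\Sigma^{1/2}$, let $P$ be an orthogonal matrix with $P^T\Sigma^{1/2}A\Sigma^{1/2}P=\mathrm{diag}(\lambda_1,\dots,\lambda_n)$, and let $(b_1,\dots,b_n)^T:=P^T\Sigma^{-1/2}\boldsymbol\mu$. Define $$c_0=\exp\left(-\tfrac12\sum_{i=1}^n b_i^2\right)\prod_{i=1}^n(2\lambda_i)^{-1/2},\qquad d_k=\tfrac12\sum_{i=1}^n(1-kb_i^2)(2\lambda_i)^{-k}\quad(k\ge1),$$ $$c_k=\frac1k\sum_{j=0}^{k-1}d_{k-j}\,c_j\quad(k\ge1).$$ The series whose tails are considered are the expansions $\sum_{k\ge0}(-1)^kc_k\,y^{n/2+k-1}/\Gamma(n/2+k)$ for the density and $\sum_{k\ge0}(-1)^kc_k\,y^{n/2+k}/\Gamma(n/2+k+1)$ for the cumulative distribution function of $\mathbf{x}^TA\mathbf{x}$. *)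

theory Defs
  imports "HOL-Probability.Probability"
begin

definition pos_def_matrix :: "real^'n^'n \<Rightarrow> bool" where
  "pos_def_matrix A \<longleftrightarrow> transpose A = A \<and> (\<forall>v. v \<noteq> 0 \<longrightarrow> v \<bullet> (A *v v) > 0)"

definition diag_matrix :: "real^'n \<Rightarrow> real^'n^'n" where
  "diag_matrix l = (\<chi> i j. if i = j then l $ i else 0)"

definition mvn_density :: "real^'n \<Rightarrow> real^'n^'n \<Rightarrow> real^'n \<Rightarrow> real" where
  "mvn_density \<mu> \<Sigma> x =
     exp (- (1/2) * ((x - \<mu>) \<bullet> (matrix_inv \<Sigma> *v (x - \<mu>))))
       / sqrt ((2 * pi) ^ CARD('n) * det \<Sigma>)"

definition d_coeff :: "real^'n \<Rightarrow> real^'n \<Rightarrow> nat \<Rightarrow> real" where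
  "d_coeff l b k = 1/2 * (\<Sum>i\<in>UNIV. (1 - real k * (b $ i)\<^sup>2) / (2 * l $ i) ^ k)"

fun c_coeff :: "real^'n \<Rightarrow> real^'n \<Rightarrow> nat \<Rightarrow> real" where
  "c_coeff l b 0 =
     exp (- (1/2) * (\<Sum>i\<in>UNIV. (b $ i)\<^sup>2)) * (\<Prod>i\<in>UNIV. (2 * l $ i) powr (-1/2))"
| "c_coeff l b (Suc k) =
     1 / real (Suc k) * (\<Sum>j\<in>{0..k}. d_coeff l b (Suc k - j) * c_coeff l b j)"

definition pdf_term :: "real^'n \<Rightarrow> real^'n \<Rightarrow> real \<Rightarrow> nat \<Rightarrow> real" where
  "pdf_term l b y k = (-1) ^ k * c_coeff l b k *
     (y powr (real CARD('n) / 2 + real k - 1) / Gamma (real CARD('n) / 2 + real k))"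

definition cdf_term :: "real^'n \<Rightarrow> real^'n \<Rightarrow> real \<Rightarrow> nat \<Rightarrow> real" where
  "cdf_term l b y k = (-1) ^ k * c_coeff l b k *
     (y powr (real CARD('n) / 2 + real k) / Gamma (real CARD('n) / 2 + real k + 1))"

definition m_bound :: "real^'n \<Rightarrow> real^'n \<Rightarrow> real \<Rightarrow> real" where
  "m_bound l b \<rho> =
     (\<Prod>i\<in>UNIV. l $ i powr (-1/2)) *
     exp (- (1/2) * (\<Sum>i\<in>UNIV. (b $ i)\<^sup>2 * l $ i / (l $ i + \<rho>))) *
     (\<Prod>i\<in>UNIV. (1 - \<rho> / l $ i) powr (-1/2))"

end

theory Submission
  imports Defs "HOL-Complex_Analysis.Complex_Analysis"
begin

text \<open>The recursion for $c_k$ says that $C(t) = \sum_k c_k t^k$ satisfies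
  $C'(t) = C(t) \sum_k d_{k+1} t^k$, which is solved in closed form by
  \[C(t) = c_0 \prod_i (1 - u_i)^{-1/2} \exp\Bigl(-\frac12 \sum_i b_i^2 \bigl((1-u_i)^{-1} - 1\bigr)\Bigr),
    \qquad u_i = \frac{t}{2\lambda_i}.\]
  On the circle $|t| = 2\rho$ one has $|1 - u_i| \geq 1 - \rho/\lambda_i$ and
  $\mathrm{Re}\,(1-u_i)^{-1} \geq \lambda_i/(\lambda_i+\rho)$, so $|C(t)| \leq 2^{-n/2} m(\rho)$, and
  Cauchy's inequality gives $|c_k| \leq 2^{-n/2} m(\rho) (2\rho)^{-k}$. Comparing
  $\Gamma(n/2+k)/\Gamma(n/2)$ with factorials then dominates both tails by tails of the
  exponential series.\<close>

no_notation fps_nth (infixl "$" 75)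

section \<open>Closed-form generating function and its differential equation\<close>

text \<open>The inverse square roots are encoded as exponentials of principal logarithms, so that
  the modulus and the logarithmic derivative both reduce to sums over i. The \<open>- 1\<close>
  makes the exponent vanish at z = 0, where the value is then \<open>c_coeff l b 0\<close>.\<close>

definition gen_fun :: "real^'n \<Rightarrow> real^'n \<Rightarrow> complex \<Rightarrow> complex" where
  "gen_fun l b z = of_real (c_coeff l b 0) *
     exp (\<Sum>i\<in>UNIV. - (1/2) * Ln (1 - of_real (1 / (2 * l $ i)) * z)
       - 1/2 * of_real ((b $ i)\<^sup>2) * (1 / (1 - of_real (1 / (2 * l $ i)) * z) - 1))"

definition gen_logderiv :: "real^'n \<Rightarrow> real^'n \<Rightarrow> complex \<Rightarrow> complex" where
  "gen_logderiv l b z = (\<Sum>i\<in>UNIV. 1/2 * of_real (1 / (2 * l $ i)) *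
     (1 / (1 - of_real (1 / (2 * l $ i)) * z)
       - of_real ((b $ i)\<^sup>2) * (1 / (1 - of_real (1 / (2 * l $ i)) * z)\<^sup>2)))"

lemma norm_scaled_less_1:
  fixes z :: complex
  assumes "0 < \<rho>" "\<rho> < a" "norm z \<le> 2 * \<rho>"
  shows "norm (of_real (1 / (2 * a)) * z) \<le> \<rho> / a" "\<rho> / a < 1"
proof -
  have "norm (of_real (1 / (2 * a)) * z) = norm z / (2 * a)"
    using assms by (simp add: norm_mult norm_divide)
  also have "\<dots> \<le> 2 * \<rho> / (2 * a)"
    using assms by (intro divide_right_mono) auto
  finally show "norm (of_real (1 / (2 * a)) * z) \<le> \<rho> / a" by simp
  show "\<rho> / a < 1" using assms by simp
qed

lemma Re_one_minus_pos:
  fixes w :: complex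
  assumes "norm w < 1"
  shows "0 < Re (1 - w)"
  using assms complex_Re_le_cmod[of w] by simp

text \<open>Singularities can occur only where some u_i = z/(2 \<lambda>_i) satisfies u_i \<ge> 1,
  and \<rho> < \<lambda>_i keeps these points off the closed disc of radius 2 \<rho>: there 1 - u_i
  has positive real part, so it avoids both 0 and the branch cut of \<open>Ln\<close>.\<close>

lemma has_field_derivative_gen_fun:
  assumes "0 < \<rho>" "\<And>i. \<rho> < l $ i" "norm z \<le> 2 * \<rho>"
  shows "(gen_fun l b has_field_derivative gen_logderiv l b z * gen_fun l b z) (at z)"
proof -
  have *: "0 < Re (1 - of_real (1 / (2 * l $ i)) * z)" for i
    using norm_scaled_less_1[OF assms(1) assms(2)[of i] assms(3)]
    by (intro Re_one_minus_pos) linarith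
  have nz: "1 - of_real (1 / (2 * l $ i)) * z \<noteq> 0" for i
    using *[of i] by (metis less_irrefl zero_complex.sel(1))
  have nr: "1 - of_real (1 / (2 * l $ i)) * z \<notin> \<real>\<^sub>\<le>\<^sub>0" for i
    using *[of i] complex_nonpos_Reals_iff by force
  have D: "((\<lambda>z. \<Sum>i\<in>UNIV. - (1/2) * Ln (1 - of_real (1 / (2 * l $ i)) * z)
       - 1/2 * of_real ((b $ i)\<^sup>2) * (1 / (1 - of_real (1 / (2 * l $ i)) * z) - 1))
      has_field_derivative gen_logderiv l b z) (at z)"
    unfolding gen_logderiv_def
  proof (rule DERIV_sum)
    fix i
    define a :: complex where "a = of_real (1 / (2 * l $ i))"
    show "((\<lambda>z. - (1/2) * Ln (1 - of_real (1 / (2 * l $ i)) * z)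
       - 1/2 * of_real ((b $ i)\<^sup>2) * (1 / (1 - of_real (1 / (2 * l $ i)) * z) - 1))
      has_field_derivative 1/2 * of_real (1 / (2 * l $ i)) *
     (1 / (1 - of_real (1 / (2 * l $ i)) * z)
       - of_real ((b $ i)\<^sup>2) * (1 / (1 - of_real (1 / (2 * l $ i)) * z)\<^sup>2))) (at z)"
      using nz[of i] nr[of i] unfolding a_def[symmetric]
      by (auto intro!: derivative_eq_intros simp: field_simps power2_eq_square)
  qed
  show ?thesis
    unfolding gen_fun_def
    by (rule derivative_eq_intros D refl | simp)+
qed

text \<open>Each summand expands by the geometric series and its derivative. With a = 1/(2
  \<lambda>_i), the coefficient at z^k is (1 - (k+1) b_i^2) a^(k+1) / 2, and summing over i gives
  d_(k+1); hence the index shift.\<close>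

lemma gen_logderiv_has_fps_expansion:
  assumes "0 < \<rho>" "\<And>i. \<rho> < l $ i"
  shows "gen_logderiv l b has_fps_expansion Abs_fps (\<lambda>k. of_real (d_coeff l b (Suc k)))"
proof (rule has_fps_expansionI)
  have "eventually (\<lambda>u::complex. u \<in> ball 0 (2 * \<rho>)) (nhds 0)"
    using assms(1) by (intro eventually_nhds_in_open) auto
  thus "\<forall>\<^sub>F u in nhds 0. (\<lambda>k. fps_nth (Abs_fps (\<lambda>k. of_real (d_coeff l b (Suc k)))) k * u ^ k)
          sums gen_logderiv l b u"
  proof eventually_elim
    case (elim u)
    have "(\<lambda>k. \<Sum>i\<in>UNIV. 1/2 * of_real (1 / (2 * l $ i)) *
        ((of_real (1 / (2 * l $ i)) * u) ^ k
         - of_real ((b $ i)\<^sup>2) * (of_nat (Suc k) * (of_real (1 / (2 * l $ i)) * u) ^ k)))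
        sums gen_logderiv l b u"
      unfolding gen_logderiv_def
    proof (intro sums_sum sums_mult sums_diff)
      fix i
      have "norm (of_real (1 / (2 * l $ i)) * u) < 1"
        using norm_scaled_less_1[OF assms(1) assms(2)[of i], of u] elim by auto
      thus "(^) (of_real (1 / (2 * l $ i)) * u) sums (1 / (1 - of_real (1 / (2 * l $ i)) * u))"
        and "(\<lambda>k. of_nat (Suc k) * (of_real (1 / (2 * l $ i)) * u) ^ k)
               sums (1 / (1 - of_real (1 / (2 * l $ i)) * u)\<^sup>2)"
        by (rule geometric_sums, rule geometric_deriv_sums)
    qed
    also have "(\<lambda>k. \<Sum>i\<in>UNIV. 1/2 * of_real (1 / (2 * l $ i)) *
        ((of_real (1 / (2 * l $ i)) * u) ^ k
         - of_real ((b $ i)\<^sup>2) * (of_nat (Suc k) * (of_real (1 / (2 * l $ i)) * u) ^ k)))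
       = (\<lambda>k. fps_nth (Abs_fps (\<lambda>k. of_real (d_coeff l b (Suc k)))) k * u ^ k)"
      by (auto simp: fun_eq_iff d_coeff_def sum_distrib_left sum_distrib_right power_mult_distrib
            power_divide field_simps diff_divide_distrib intro!: sum.cong simp del: of_nat_Suc)
    finally show ?case .
  qed
qed

lemma gen_fun_holomorphic:
  assumes "0 < \<rho>" "\<And>i. \<rho> < l $ i"
  shows "gen_fun l b holomorphic_on cball 0 (2 * \<rho>)"
  unfolding holomorphic_on_def
proof
  fix z :: complex assume "z \<in> cball 0 (2 * \<rho>)"
  hence "(gen_fun l b has_field_derivative gen_logderiv l b z * gen_fun l b z) (at z)"
    by (intro has_field_derivative_gen_fun[OF assms]) auto
  thus "gen_fun l b field_differentiable at z within cball 0 (2 * \<rho>)"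
    using field_differentiable_at_within field_differentiable_def by blast
qed

text \<open>Holomorphy provides some expansion F. The differential equation near 0 becomes an
  identity F' = D F of formal power series, whose coefficient at z^m reads (m+1) F_(m+1) = \<Sum>_(j
  \<le> m) d_(m+1-j) F_j. This is the recursion of c_k, with the same initial value.\<close>

lemma gen_fun_has_fps_expansion:
  assumes "0 < \<rho>" "\<And>i. \<rho> < l $ i"
  shows "gen_fun l b has_fps_expansion Abs_fps (\<lambda>k. of_real (c_coeff l b k))"
proof -
  define F where "F = fps_expansion (gen_fun l b) 0"
  have F: "gen_fun l b has_fps_expansion F"
    unfolding F_def
    by (rule has_fps_expansion_fps_expansion[of "ball 0 (2 * \<rho>)"])
       (use gen_fun_holomorphic[OF assms] assms(1) in
         \<open>auto intro: holomorphic_on_subset[OF _ ball_subset_cball]\<close>)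
  have "eventually (\<lambda>u::complex. u \<in> ball 0 (2 * \<rho>)) (nhds 0)"
    using assms(1) by (intro eventually_nhds_in_open) auto
  hence "eventually (\<lambda>u. deriv (gen_fun l b) u = gen_logderiv l b u * gen_fun l b u) (nhds 0)"
    by eventually_elim (auto intro!: DERIV_imp_deriv has_field_derivative_gen_fun[OF assms])
  moreover have "(\<lambda>u. gen_logderiv l b u * gen_fun l b u) has_fps_expansion
      Abs_fps (\<lambda>k. of_real (d_coeff l b (Suc k))) * F"
    by (intro has_fps_expansion_mult F gen_logderiv_has_fps_expansion[OF assms])
  ultimately have "deriv (gen_fun l b) has_fps_expansion
      Abs_fps (\<lambda>k. of_real (d_coeff l b (Suc k))) * F"
    by (subst has_fps_expansion_cong[OF _ refl])
  with has_fps_expansion_deriv[OF F]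
  have ode: "fps_deriv F = Abs_fps (\<lambda>k. of_real (d_coeff l b (Suc k))) * F"
    by (rule fps_expansion_unique_complex)
  have "fps_nth F k = of_real (c_coeff l b k)" for k
  proof (induction k rule: less_induct)
    case (less k)
    show ?case
    proof (cases k)
      case 0
      thus ?thesis
        using has_fps_expansion_imp_0_eq_fps_nth_0[OF F] by (simp add: gen_fun_def)
    next
      case (Suc m)
      have "of_nat (Suc m) * fps_nth F (Suc m) = fps_nth (fps_deriv F) m" by simp
      also have "\<dots> = (\<Sum>j=0..m. fps_nth F j * of_real (d_coeff l b (Suc (m - j))))"
        unfolding ode by (subst mult.commute) (simp add: fps_mult_nth)
      also have "\<dots> = (\<Sum>j=0..m. of_real (d_coeff l b (Suc m - j) * c_coeff l b j))"
        by (intro sum.cong refl) (use less Suc in \<open>auto simp: Suc_diff_le\<close>)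
      also have "\<dots> = of_nat (Suc m) * of_real (c_coeff l b (Suc m))"
        by (simp del: of_nat_Suc)
      finally show ?thesis using Suc by (simp del: of_nat_Suc c_coeff.simps)
    qed
  qed
  hence "F = Abs_fps (\<lambda>k. of_real (c_coeff l b k))" by (intro fps_ext) simp
  thus ?thesis using F by simp
qed

section \<open>Bound on the disc of radius 2 \<rho> and Cauchy's estimate\<close>

text \<open>The map 1/(1 - w) sends the disc of radius q to the disc with diameter
  [1/(1+q), 1/(1-q)], so the real part is smallest at w = -q.\<close>

lemma Re_inverse_one_minus_ge:
  fixes w :: complex
  assumes "norm w \<le> q" "q < 1"
  shows "1 / (1 + q) \<le> Re (1 / (1 - w))"
proof -
  have q: "0 \<le> q" using assms(1) norm_ge_zero order_trans by blast
  have "0 < Re (1 - w)" using assms by (intro Re_one_minus_pos) simp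
  hence "1 - w \<noteq> 0" by auto
  hence pos: "0 < (norm (1 - w))\<^sup>2" by simp
  have "(norm w)\<^sup>2 \<le> q\<^sup>2" using assms by (intro power_mono) auto
  hence sq: "(Re w)\<^sup>2 + (Im w)\<^sup>2 \<le> q\<^sup>2" by (simp add: cmod_power2)
  have "- q \<le> Re w" using abs_Re_le_cmod[of w] assms by linarith
  \<comment> \<open>This product is exactly the excess of (1 + q)(1 - Re w) over 1 - 2 Re w + q^2,
    and the latter bounds |1 - w|^2 from above.\<close>
  hence "0 \<le> (q + Re w) * (1 - q)" using assms by simp
  hence "(norm (1 - w))\<^sup>2 \<le> (1 + q) * Re (1 - w)"
    using sq unfolding cmod_power2 by (simp add: power2_eq_square algebra_simps)
  thus ?thesis using pos q by (simp add: Re_divide' cmod_power2 field_simps)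
qed

text \<open>The power of 2 accounts for c_0 containing (2 \<lambda>_i)^(-1/2) where m(\<rho>) has
  \<lambda>_i^(-1/2).\<close>

definition coeff_bound :: "real^'n \<Rightarrow> real^'n \<Rightarrow> real \<Rightarrow> real" where
  "coeff_bound l b \<rho> = 2 powr (- real CARD('n) / 2) * m_bound l b \<rho>"

text \<open>Brings the bound into the shape of \<open>gen_fun\<close>, a product times the
  exponential of a sum over i, so that the exponents can be compared summand by summand.\<close>

lemma coeff_bound_eq:
  fixes l b :: "real^'n"
  assumes "0 < \<rho>" "\<And>i. \<rho> < l $ i"
  shows "coeff_bound l b \<rho> = (\<Prod>i\<in>UNIV. (2 * l $ i) powr (-1/2)) *
    exp (\<Sum>i\<in>UNIV. - (1/2) * ln (1 - \<rho> / l $ i) - 1/2 * (b $ i)\<^sup>2 * (1 / (1 + \<rho> / l $ i)))"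
proof -
  have l: "0 < l $ i" for i using assms less_trans by blast
  have "(2::real) powr (- real CARD('n) / 2) = (\<Prod>i\<in>(UNIV::'n set). 2 powr (-1/2))"
    by (simp add: powr_powr flip: powr_realpow)
  hence 1: "(2::real) powr (- real CARD('n) / 2) * (\<Prod>i\<in>UNIV. l $ i powr (-1/2))
      = (\<Prod>i\<in>UNIV. (2 * l $ i) powr (-1/2))"
    using l by (simp add: powr_mult less_imp_le prod.distrib)
  have 2: "(\<Prod>i\<in>UNIV. (1 - \<rho> / l $ i) powr (-1/2))
      = exp (\<Sum>i\<in>UNIV. - (1/2) * ln (1 - \<rho> / l $ i))"
    unfolding exp_sum[OF finite]
    using assms l by (intro prod.cong refl) (auto simp: powr_def field_simps less_imp_neq)
  have 3: "- (1/2) * (\<Sum>i\<in>UNIV. (b $ i)\<^sup>2 * l $ i / (l $ i + \<rho>))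
      = (\<Sum>i\<in>UNIV. - (1/2 * (b $ i)\<^sup>2 * (1 / (1 + \<rho> / l $ i))))"
    unfolding sum_distrib_left
  proof (intro sum.cong refl)
    fix i show "- (1/2) * ((b $ i)\<^sup>2 * l $ i / (l $ i + \<rho>)) = - (1/2 * (b $ i)\<^sup>2 * (1 / (1 + \<rho> / l $ i)))"
      using l[of i] assms(1) by (simp add: field_simps)
  qed
  have "coeff_bound l b \<rho> = (\<Prod>i\<in>UNIV. (2 * l $ i) powr (-1/2)) *
      exp ((\<Sum>i\<in>UNIV. - (1/2) * ln (1 - \<rho> / l $ i))
        + (\<Sum>i\<in>UNIV. - (1/2 * (b $ i)\<^sup>2 * (1 / (1 + \<rho> / l $ i)))))"
    unfolding coeff_bound_def m_bound_def 2 3 exp_add 1[symmetric] by (simp only: mult_ac)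
  thus ?thesis by (simp only: sum.distrib[symmetric] diff_conv_add_uminus)
qed

lemma norm_gen_fun_le:
  assumes "0 < \<rho>" "\<And>i. \<rho> < l $ i" "norm z \<le> 2 * \<rho>"
  shows "norm (gen_fun l b z) \<le> coeff_bound l b \<rho>"
proof -
  define w where "w i = of_real (1 / (2 * l $ i)) * z" for i
  have w: "norm (w i) \<le> \<rho> / l $ i" "\<rho> / l $ i < 1" for i
    using norm_scaled_less_1[OF assms(1) assms(2)[of i] assms(3)] by (auto simp: w_def)
  \<comment> \<open>The factor exp(-1/2 \<Sum> b_i^2) of c_0 cancels against the \<open>- 1\<close>
    in the exponent, so only the product survives from c_0.\<close>
  have "gen_fun l b z = of_real (\<Prod>i\<in>UNIV. (2 * l $ i) powr (-1/2)) *
     exp (\<Sum>i\<in>UNIV. - (1/2) * Ln (1 - w i) - 1/2 * of_real ((b $ i)\<^sup>2) * (1 / (1 - w i)))"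
    unfolding gen_fun_def w_def[symmetric] c_coeff.simps of_real_mult exp_of_real[symmetric]
    by (simp add: exp_add[symmetric] algebra_simps sum.distrib sum_subtractf sum_negf
        sum_distrib_left sum_divide_distrib diff_divide_distrib mult_exp_exp)
  hence "norm (gen_fun l b z) = (\<Prod>i\<in>UNIV. (2 * l $ i) powr (-1/2)) *
      exp (\<Sum>i\<in>UNIV. Re (- (1/2) * Ln (1 - w i) - 1/2 * of_real ((b $ i)\<^sup>2) * (1 / (1 - w i))))"
    by (simp add: norm_mult prod_nonneg del: of_real_prod)
  also have "\<dots> \<le> coeff_bound l b \<rho>"
    unfolding coeff_bound_eq[OF assms(1,2)]
  proof (intro mult_left_mono iffD2[OF exp_le_cancel_iff] sum_mono prod_nonneg ballI)
    fix i
    have "1 - \<rho> / l $ i \<le> norm (1 - w i)"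
      using norm_triangle_ineq2[of 1 "w i"] w(1)[of i] by simp
    hence "ln (1 - \<rho> / l $ i) \<le> ln (norm (1 - w i))"
      using w(2)[of i] by (intro ln_mono) auto
    moreover have "Re (Ln (1 - w i)) = ln (norm (1 - w i))" using w[of i] by (intro Re_Ln) auto
    moreover have "(b $ i)\<^sup>2 * (1 / (1 + \<rho> / l $ i)) \<le> (b $ i)\<^sup>2 * Re (1 / (1 - w i))"
      by (intro mult_left_mono Re_inverse_one_minus_ge w) auto
    moreover have "Re (- (1/2) * L - 1/2 * of_real \<beta> * V) = - (1/2) * Re L - 1/2 * (\<beta> * Re V)"
      for L V :: complex and \<beta>
      by simp
    ultimately show "Re (- (1/2) * Ln (1 - w i) - 1/2 * of_real ((b $ i)\<^sup>2) * (1 / (1 - w i)))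
        \<le> - (1/2) * ln (1 - \<rho> / l $ i) - 1/2 * (b $ i)\<^sup>2 * (1 / (1 + \<rho> / l $ i))"
      by (simp only: mult.assoc)
  qed auto
  finally show ?thesis .
qed

lemma abs_c_coeff_le:
  assumes "0 < \<rho>" "\<And>i. \<rho> < l $ i"
  shows "\<bar>c_coeff l b k\<bar> \<le> coeff_bound l b \<rho> / (2 * \<rho>) ^ k"
proof -
  have "norm ((deriv ^^ k) (gen_fun l b) 0) \<le> fact k * coeff_bound l b \<rho> / (2 * \<rho>) ^ k"
  proof (rule Cauchy_inequality)
    show "gen_fun l b holomorphic_on ball 0 (2 * \<rho>)"
      using gen_fun_holomorphic[OF assms] holomorphic_on_subset ball_subset_cball by blast
    show "continuous_on (cball 0 (2 * \<rho>)) (gen_fun l b)"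
      by (intro holomorphic_on_imp_continuous_on gen_fun_holomorphic[OF assms])
    show "norm (gen_fun l b z) \<le> coeff_bound l b \<rho>" if "norm (0 - z) = 2 * \<rho>" for z
      using that by (intro norm_gen_fun_le[OF assms]) auto
  qed (use assms in auto)
  moreover have "of_real (c_coeff l b k) = (deriv ^^ k) (gen_fun l b) 0 / fact k"
    using fps_nth_fps_expansion[OF gen_fun_has_fps_expansion[OF assms], where n = k] by simp
  hence "\<bar>c_coeff l b k\<bar> = norm ((deriv ^^ k) (gen_fun l b) 0) / fact k"
    by (metis norm_of_real norm_divide norm_fact)
  ultimately have "\<bar>c_coeff l b k\<bar> \<le> fact k * coeff_bound l b \<rho> / (2 * \<rho>) ^ k / fact k"
    by (simp only: divide_right_mono fact_ge_zero)
  thus ?thesis by simp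
qed

section \<open>Tails of the exponential series\<close>

text \<open>Since (k+n)! \<ge> k! n!, the factor z^n/n! can be pulled out of the tail, leaving at
  most the full series of exp z.\<close>

lemma exp_tail:
  fixes z :: real
  assumes "0 \<le> z"
  shows "summable (\<lambda>k. z ^ (k + n) / fact (k + n))"
    and "(\<Sum>k. z ^ (k + n) / fact (k + n)) \<le> z ^ n / fact n * exp z"
proof -
  have e: "(\<lambda>k. z ^ k / fact k) sums exp z"
    using exp_converges[of z] by (simp add: divide_inverse mult.commute)
  have le: "z ^ (k + n) / fact (k + n) \<le> z ^ n / fact n * (z ^ k / fact k)" for k
  proof -
    have "(fact n * fact k :: nat) \<le> fact (k + n)"
      by (metis add.commute dvd_imp_le fact_fact_dvd_fact fact_gt_zero)
    hence "(fact n * fact k :: real) \<le> fact (k + n)"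
      by (metis of_nat_fact of_nat_le_iff of_nat_mult)
    hence "z ^ (k + n) / fact (k + n) \<le> z ^ (k + n) / (fact n * fact k)"
      using assms by (intro divide_left_mono) auto
    thus ?thesis by (simp add: power_add mult_ac)
  qed
  have s: "(\<lambda>k. z ^ n / fact n * (z ^ k / fact k)) sums (z ^ n / fact n * exp z)"
    by (intro sums_mult e)
  show 1: "summable (\<lambda>k. z ^ (k + n) / fact (k + n))"
    using e by (subst summable_iff_shift) (simp add: sums_iff)
  show "(\<Sum>k. z ^ (k + n) / fact (k + n)) \<le> z ^ n / fact n * exp z"
    using suminf_le[OF le 1] s by (simp add: sums_iff)
qed

lemma abs_suminf_le_exp_tail:
  fixes f :: "nat \<Rightarrow> real"
  assumes "0 \<le> z" "0 \<le> C" and le: "\<And>k. \<bar>f k\<bar> \<le> C * (z ^ (k + n) / fact (k + n))"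
  shows "summable f" "\<bar>\<Sum>k. f k\<bar> \<le> C * (z ^ n / fact n * exp z)"
proof -
  have sm: "summable (\<lambda>k. C * (z ^ (k + n) / fact (k + n)))"
    by (intro summable_mult exp_tail assms)
  have sa: "summable (\<lambda>k. \<bar>f k\<bar>)"
    by (rule summable_comparison_test_ev[OF _ sm]) (use le in auto)
  thus "summable f" by (rule summable_rabs_cancel)
  have "\<bar>\<Sum>k. f k\<bar> \<le> (\<Sum>k. \<bar>f k\<bar>)" by (rule summable_rabs[OF sa])
  also have "\<dots> \<le> (\<Sum>k. C * (z ^ (k + n) / fact (k + n)))" by (rule suminf_le[OF le sa sm])
  also have "\<dots> = C * (\<Sum>k. z ^ (k + n) / fact (k + n))"
    by (rule suminf_mult[OF exp_tail(1)[OF assms(1)]])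
  also have "\<dots> \<le> C * (z ^ n / fact n * exp z)"
    by (intro mult_left_mono exp_tail assms)
  finally show "\<bar>\<Sum>k. f k\<bar> \<le> C * (z ^ n / fact n * exp z)" .
qed

section \<open>Elementary inequalities for the first two coefficients in dimension one\<close>

lemma sqrt_one_minus_le:
  assumes "r \<le> 1" shows "sqrt (1 - r) \<le> 1 - r / 2"
  using arith_geo_mean_sqrt[of 1 "1 - r"] assms by simp

text \<open>The cubic term is kept because the estimate of c_2 has to dominate 9/8 x^2, whose
  coefficient is larger than that of the quadratic Taylor term.\<close>

lemma exp_ge_cubic:
  fixes x :: real
  assumes "0 \<le> x" shows "1 + x + x\<^sup>2 / 2 + x ^ 3 / 6 \<le> exp x"
proof -
  have e: "(\<lambda>k. x ^ k / fact k) sums exp x"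
    using exp_converges[of x] by (simp add: divide_inverse mult.commute)
  have "(\<Sum>k<4. x ^ k / fact k) \<le> (\<Sum>k. x ^ k / fact k)"
    by (intro sum_le_suminf) (use e assms in \<open>auto simp: sums_iff\<close>)
  thus ?thesis using e by (simp add: numeral_eq_Suc sums_iff)
qed

text \<open>After the square root is linearised, the quadratic (1 + r)(1 - r/2) has its maximum 9/8
  at r = 1/2.\<close>

lemma one_plus_mult_sqrt_one_minus_le:
  fixes r :: real
  assumes "0 \<le> r" "r \<le> 1" shows "(1 + r) * sqrt (1 - r) \<le> 9 / 8"
proof -
  have "(1 + r) * sqrt (1 - r) \<le> (1 + r) * (1 - r / 2)"
    using assms by (intro mult_left_mono sqrt_one_minus_le) auto
  also have "\<dots> = 9 / 8 - (r - 1/2)\<^sup>2 / 2" by (simp add: field_simps power2_eq_square)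
  also have "\<dots> \<le> 9 / 8" by simp
  finally show ?thesis .
qed

text \<open>The next two lemmas bound $c_1$ and $c_2$ in dimension one, with $s = b_1^2$ and
  $r = \rho/\lambda_1$. There $\Gamma(n/2+k+1) \geq k!\,\Gamma(n/2)$ fails for $k = 1, 2$, so that
  Cauchy's estimate alone misses the claimed constant for the distribution function.\<close>

lemma first_coeff_estimate:
  fixes r s :: real
  assumes "0 < r" "r < 1" "0 \<le> s"
  shows "2/3 * \<bar>1 - s\<bar> * r * sqrt (1 - r) \<le> exp (s * r / (2 * (1 + r)))"
proof -
  \<comment> \<open>x is the exponent on the right. Replacing s r by 2 (1 + r) x separates the
    variables: the factors in r are bounded by constants, and a polynomial in x is left to compare
    with exp x.\<close>
  define x where "x = s * r / (2 * (1 + r))"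
  have x: "0 \<le> x" "s * r = 2 * (1 + r) * x" using assms by (auto simp: x_def field_simps)
  have u: "(1 + r) * sqrt (1 - r) \<le> 9 / 8"
    using assms by (intro one_plus_mult_sqrt_one_minus_le) auto
  have "0 \<le> x\<^sup>2" "0 \<le> x ^ 3" using x(1) by auto
  hence e: "1 + x + x\<^sup>2 / 2 \<le> exp x" "1 \<le> exp x" using exp_ge_cubic[OF x(1)] x(1) by linarith+
  have "r * sqrt (1 - r) \<le> 1 * 1" using assms by (intro mult_mono) auto
  hence r1: "2/3 * (r * sqrt (1 - r)) \<le> exp x" using e(2) by linarith
  have "s * r * sqrt (1 - r) = 2 * x * ((1 + r) * sqrt (1 - r))" using x(2) by simp
  also have "\<dots> \<le> 2 * x * (9 / 8)" using x(1) u by (intro mult_left_mono) auto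
  finally have "2/3 * (s * r * sqrt (1 - r)) \<le> 3/2 * x" by simp
  \<comment> \<open>Completing the square in 1 - x/2 + x^2/2 leaves the positive remainder
    7/8.\<close>
  also have "\<dots> = 1 + x + x\<^sup>2 / 2 - ((x - 1/2)\<^sup>2 / 2 + 7/8)"
    by (simp add: field_simps power2_eq_square)
  also have "\<dots> \<le> exp x" using e(1) zero_le_power2[of "x - 1/2"] by linarith
  finally have r2: "2/3 * (s * r * sqrt (1 - r)) \<le> exp x" .
  have rs: "0 \<le> r * sqrt (1 - r)" using assms by simp
  have "2/3 * \<bar>1 - s\<bar> * r * sqrt (1 - r) = 2/3 * (\<bar>1 - s\<bar> * (r * sqrt (1 - r)))" by simp
  also have "\<dots> \<le> 2/3 * (max 1 s * (r * sqrt (1 - r)))"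
    using rs assms by (intro mult_left_mono mult_right_mono) auto
  also have "\<dots> \<le> exp x" using r1 r2 by (auto simp: max_def mult_ac)
  finally show ?thesis unfolding x_def .
qed

lemma second_coeff_estimate:
  fixes r s :: real
  assumes "0 < r" "r < 1" "0 \<le> s"
  shows "r\<^sup>2 / 8 * \<bar>s\<^sup>2 - 6 * s + 3\<bar> * sqrt (1 - r) \<le> 15/16 * exp (s * r / (2 * (1 + r)))"
proof -
  define x where "x = s * r / (2 * (1 + r))"
  define q where "q = sqrt (1 - r)"
  have q: "0 \<le> q" "q \<le> 1 - r / 2"
    using assms sqrt_one_minus_le[of r] by (auto simp: q_def)
  have x: "0 \<le> x" "s * r = 2 * (1 + r) * x" using assms by (auto simp: x_def field_simps)
  have u: "(1 + r) * q \<le> 9 / 8"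
    unfolding q_def using assms by (intro one_plus_mult_sqrt_one_minus_le) auto
  have "0 \<le> x\<^sup>2" "0 \<le> x ^ 3" using x(1) by auto
  hence e: "1 + x + x\<^sup>2 / 2 \<le> exp x" using exp_ge_cubic[OF x(1)] by linarith
  have "(1 + r) * ((1 + r) * q) \<le> 2 * (9 / 8)" using u q assms by (intro mult_mono) auto
  hence A: "x\<^sup>2 * ((1 + r) * ((1 + r) * q)) \<le> x\<^sup>2 * (9 / 4)" by (intro mult_left_mono) auto
  have "r * (r * q) \<le> 1 * (r * (1 - r / 2))" using assms q by (intro mult_mono) auto
  also have "\<dots> = 1/2 - (1 - r)\<^sup>2 / 2" by (simp add: field_simps power2_eq_square)
  also have "\<dots> \<le> 1/2" by simp
  finally have B: "r * (r * q) \<le> 1/2" .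
  have "r * ((1 + r) * q) \<le> 1 * (9 / 8)" using u q assms by (intro mult_mono) auto
  hence D: "x * (r * ((1 + r) * q)) \<le> x * (9 / 8)" using x(1) by (intro mult_left_mono) auto

  have "r\<^sup>2 / 8 * (s\<^sup>2 + 3) * q = (s * r)\<^sup>2 * q / 8 + 3/8 * (r * (r * q))"
    by (simp add: field_simps power2_eq_square)
  also have "(s * r)\<^sup>2 * q / 8 = x\<^sup>2 * ((1 + r) * ((1 + r) * q)) / 2"
    unfolding x(2) by (simp add: power2_eq_square algebra_simps)
  also have "\<dots> + 3/8 * (r * (r * q)) \<le> 9/8 * x\<^sup>2 + 3/16" using A B by linarith
  \<comment> \<open>The number 21/10 is chosen so that 5/32 x (x - 21/10)^2 absorbs the cubic and
    quadratic terms of the difference; the linear and constant terms left over are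
    nonnegative.\<close>
  also have "\<dots> = 15/16 * (1 + x + x\<^sup>2 / 2 + x ^ 3 / 6)
      - (5/32 * (x * (x - 21/10)\<^sup>2) + 159/640 * x + 3/4)"
    by (simp add: field_simps power2_eq_square power3_eq_cube)
  also have "\<dots> \<le> 15/16 * (1 + x + x\<^sup>2 / 2 + x ^ 3 / 6)"
  proof -
    have "0 \<le> 5/32 * (x * (x - 21/10)\<^sup>2) + 159/640 * x + 3/4"
      using x(1) by (intro add_nonneg_nonneg mult_nonneg_nonneg) auto
    thus ?thesis by (simp only: diff_le_eq le_add_same_cancel1)
  qed
  also have "\<dots> \<le> 15/16 * exp x" by (intro mult_left_mono exp_ge_cubic x) auto
  finally have r1: "r\<^sup>2 / 8 * (s\<^sup>2 + 3) * q \<le> 15/16 * exp x" .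

  have "r\<^sup>2 / 8 * (6 * s) * q = 3/4 * r * (s * r) * q" by (simp add: power2_eq_square)
  also have "\<dots> = 3/2 * (x * (r * ((1 + r) * q)))" unfolding x(2) by simp
  also have "\<dots> \<le> 27/16 * x" using D by linarith
  \<comment> \<open>The quadratic Taylor polynomial suffices here: the difference is smallest at x =
    4/5, with value 51/80.\<close>
  also have "\<dots> = 15/16 * (1 + x + x\<^sup>2 / 2) - (15/32 * (x - 4/5)\<^sup>2 + 51/80)"
    by (simp add: field_simps power2_eq_square)
  also have "\<dots> \<le> 15/16 * (1 + x + x\<^sup>2 / 2)"
  proof -
    have "0 \<le> 15/32 * (x - 4/5)\<^sup>2 + 51/80" by simp
    thus ?thesis by (simp only: diff_le_eq le_add_same_cancel1)
  qed
  also have "\<dots> \<le> 15/16 * exp x" using e by simp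
  finally have r2: "r\<^sup>2 / 8 * (6 * s) * q \<le> 15/16 * exp x" .

  \<comment> \<open>For s \<ge> 0 the polynomial is a difference of the nonnegative quantities s^2 +
    3 and 6 s, so its modulus is at most the larger one. Each was bounded separately above.\<close>
  have "r\<^sup>2 / 8 * \<bar>s\<^sup>2 - 6 * s + 3\<bar> * q \<le> r\<^sup>2 / 8 * max (s\<^sup>2 + 3) (6 * s) * q"
  proof (intro mult_right_mono mult_left_mono)
    show "\<bar>s\<^sup>2 - 6 * s + 3\<bar> \<le> max (s\<^sup>2 + 3) (6 * s)"
      using assms(3) zero_le_power2[of s] by linarith
  qed (use q(1) in auto)
  also have "\<dots> \<le> 15/16 * exp x" using r1 r2 by (auto simp: max_def)
  finally show ?thesis unfolding x_def q_def .
qed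

section \<open>Factorials against rising factorials\<close>

text \<open>k = 3 is the first index where this holds, as 6 \<le> 105/16. From there each step
  multiplies the left side by k + 1 and the right side by k + 3/2.\<close>

lemma fact_le_pochhammer_half:
  assumes "3 \<le> k" shows "fact k \<le> pochhammer (1/2 :: real) (Suc k)"
  using assms
proof (induction k rule: dec_induct)
  case base
  show ?case by (simp add: numeral_eq_Suc pochhammer_Suc)
next
  case (step k)
  have "(fact (Suc k) :: real) = (real k + 1) * fact k" by simp
  also have "\<dots> \<le> (real k + 3/2) * pochhammer (1/2) (Suc k)"
    using step by (intro mult_mono) auto
  also have "\<dots> = pochhammer (1/2) (Suc (Suc k))"
    by (simp add: pochhammer_Suc[of _ "Suc k"] mult.commute)
  finally show ?case .
qed

text \<open>The factor 2 is forced by k = 0, a = 1/2, where equality holds. The density bound can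
  afford it, because its power of y/2 has exponent n/2 - 1.\<close>

lemma fact_le_two_mult_pochhammer:
  fixes a :: real
  assumes "1/2 \<le> a" shows "fact k \<le> 2 * pochhammer a (Suc k)"
proof (induction k)
  case 0
  thus ?case using assms by simp
next
  case (Suc k)
  have "(fact (Suc k) :: real) = (real k + 1) * fact k" by simp
  also have "\<dots> \<le> (a + real (Suc k)) * (2 * pochhammer a (Suc k))"
    using Suc assms by (intro mult_mono) auto
  also have "\<dots> = 2 * pochhammer a (Suc (Suc k))"
    by (simp add: pochhammer_Suc[of _ "Suc k"] mult_ac)
  finally show ?case .
qed

lemma fact_le_pochhammer:
  fixes a :: real
  assumes "1 \<le> a" shows "fact k \<le> pochhammer a k"
proof (induction k)
  case (Suc k)
  have "(fact (Suc k) :: real) = (real k + 1) * fact k" by simp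
  also have "\<dots> \<le> (a + real k) * pochhammer a k"
    using Suc assms by (intro mult_mono) auto
  finally show ?case by (simp add: pochhammer_Suc mult_ac)
qed simp

section \<open>Coefficients divided by rising factorials\<close>

lemma coeff_bound_nonneg: "0 \<le> coeff_bound l b \<rho>"
  by (simp add: coeff_bound_def m_bound_def prod_nonneg)

text \<open>With a single eigenvalue everything is a multiple of c_0: the bound is c_0 exp x /
  sqrt(1 - r), and c_k (2 \<rho>)^k is c_0 r^k times a polynomial in s. Dividing by c_0 leaves
  \<open>first_coeff_estimate\<close> or \<open>second_coeff_estimate\<close>.\<close>

lemma abs_c_coeff_div_pochhammer_le_dim_1:
  fixes l b :: "real^'n"
  assumes "0 < \<rho>" "\<And>i. \<rho> < l $ i" and card: "CARD('n) = 1" and k: "k = 1 \<or> k = 2"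
  shows "\<bar>c_coeff l b k\<bar> / pochhammer (1/2) (Suc k) \<le> coeff_bound l b \<rho> / ((2 * \<rho>) ^ k * fact k)"
proof -
  obtain i :: 'n where U: "UNIV = {i}" using card by (rule card_1_singletonE)
  define s where "s = (b $ i)\<^sup>2"
  define r where "r = \<rho> / l $ i"
  define x where "x = s * r / (2 * (1 + r))"
  define c where "c = c_coeff l b 0"
  have l: "0 < l $ i" using assms less_trans by blast
  have r: "0 < r" "r < 1" using assms l by (auto simp: r_def)
  have s: "0 \<le> s" by (simp add: s_def)
  have c: "0 < c" using l by (simp add: c_def U)
  have lr: "l $ i = \<rho> / r" using l assms(1) by (simp add: r_def)
  have x': "x = s / 2 - 1/2 * s * (1 / (1 + r))" using r by (simp add: x_def field_simps)
  have sq: "exp (1/2 * ln (1 - r)) = sqrt (1 - r)"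
    using r by (simp add: powr_half_sqrt[symmetric] powr_def)
  have "coeff_bound l b \<rho> = c * exp (s / 2) * exp (- (1/2) * ln (1 - r) - 1/2 * s * (1 / (1 + r)))"
    unfolding coeff_bound_eq[OF assms(1,2)] using c_def
    by (simp add: U s_def r_def exp_minus mult_ac)
  also have "\<dots> = c * (exp x / exp (1/2 * ln (1 - r)))"
    unfolding x' by (simp add: mult_exp_exp exp_diff[symmetric] algebra_simps)
  finally have K: "coeff_bound l b \<rho> = c * (exp x / sqrt (1 - r))" unfolding sq .
  have d: "d_coeff l b k * (2 * \<rho>) ^ k = 1/2 * (1 - real k * s) * r ^ k" for k
    using assms(1) r by (simp add: d_coeff_def U s_def lr power_divide)
  have c1: "c_coeff l b 1 = d_coeff l b 1 * c" by (simp add: c_def)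
  show ?thesis
    using k
  proof
    assume k: "k = 1"
    \<comment> \<open>3/4 is \<open>pochhammer (1/2) 2\<close>; dividing the 1/2 from d_1 by it
      gives the constant 2/3.\<close>
    have "\<bar>c_coeff l b 1\<bar> * (2 * \<rho>) / (3/4) = c * (2/3 * \<bar>1 - s\<bar> * r)"
    proof -
      have "\<bar>c_coeff l b 1\<bar> * (2 * \<rho>) = \<bar>c_coeff l b 1 * (2 * \<rho>)\<bar>"
        using assms(1) by (simp add: abs_mult)
      also have "c_coeff l b 1 * (2 * \<rho>) = c * (1/2 * (1 - s) * r)"
        using d[of 1] unfolding c1 by (simp add: mult_ac del: c_coeff.simps)
      also have "\<bar>c * (1/2 * (1 - s) * r)\<bar> = c * (1/2 * \<bar>1 - s\<bar> * r)"
        using c r by (simp add: abs_mult)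
      finally have "\<bar>c_coeff l b 1\<bar> * (2 * \<rho>) = c * (1/2 * \<bar>1 - s\<bar> * r)" .
      thus ?thesis by (simp add: mult_ac del: c_coeff.simps)
    qed
    also have "\<dots> \<le> c * (exp x / sqrt (1 - r))"
      using first_coeff_estimate[OF r s] c r by (intro mult_left_mono) (auto simp: pos_le_divide_eq x_def)
    finally have "\<bar>c_coeff l b 1\<bar> * (2 * \<rho>) / (3/4) \<le> coeff_bound l b \<rho>" unfolding K .
    thus ?thesis using assms(1) k by (simp add: pochhammer_Suc field_simps)
  next
    assume k: "k = 2"
    have c2: "c_coeff l b 2 = (d_coeff l b 2 + (d_coeff l b 1)\<^sup>2) / 2 * c"
    proof -
      have "c_coeff l b (Suc 1) = 1/2 * (d_coeff l b 2 * c + d_coeff l b 1 * c_coeff l b 1)"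
        by (subst c_coeff.simps(2)) (simp add: c_def numeral_2_eq_2 del: c_coeff.simps)
      thus ?thesis unfolding c1 by (simp add: power2_eq_square algebra_simps numeral_2_eq_2 del: c_coeff.simps)
    qed
    have "c_coeff l b 2 * (2 * \<rho>)\<^sup>2
        = (d_coeff l b 2 * (2 * \<rho>)\<^sup>2 + (d_coeff l b 1 * (2 * \<rho>) ^ 1)\<^sup>2) / 2 * c"
      unfolding c2 by (simp add: power_mult_distrib algebra_simps)
    also have "\<dots> = c * (r\<^sup>2 / 8 * (s\<^sup>2 - 6 * s + 3))"
      unfolding d by (simp add: power2_eq_square field_simps)
    finally have "\<bar>c_coeff l b 2 * (2 * \<rho>)\<^sup>2\<bar> = \<bar>c * (r\<^sup>2 / 8 * (s\<^sup>2 - 6 * s + 3))\<bar>" by simp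
    hence "\<bar>c_coeff l b 2\<bar> * (2 * \<rho>)\<^sup>2 = c * (r\<^sup>2 / 8 * \<bar>s\<^sup>2 - 6 * s + 3\<bar>)"
      using c by (simp only: abs_mult abs_of_pos abs_divide abs_numeral abs_power2)
    \<comment> \<open>15/16 is \<open>pochhammer (1/2) 3\<close> = 15/8 divided by
      \<open>fact 2\<close>.\<close>
    also have "\<dots> \<le> c * (15/16 * (exp x / sqrt (1 - r)))"
    proof (intro mult_left_mono)
      have "r\<^sup>2 / 8 * \<bar>s\<^sup>2 - 6 * s + 3\<bar> * sqrt (1 - r) \<le> 15/16 * exp x"
        using second_coeff_estimate[OF r s] by (simp add: x_def)
      hence "r\<^sup>2 / 8 * \<bar>s\<^sup>2 - 6 * s + 3\<bar> \<le> 15/16 * exp x / sqrt (1 - r)"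
        using r by (simp only: pos_le_divide_eq real_sqrt_gt_0_iff diff_gt_0_iff_gt)
      thus "r\<^sup>2 / 8 * \<bar>s\<^sup>2 - 6 * s + 3\<bar> \<le> 15/16 * (exp x / sqrt (1 - r))" by simp
    qed (use c in simp)
    finally have "\<bar>c_coeff l b 2\<bar> * (2 * \<rho>)\<^sup>2 \<le> 15/16 * coeff_bound l b \<rho>" unfolding K by simp
    thus ?thesis using assms(1) k by (simp add: pochhammer_Suc numeral_2_eq_2 field_simps)
  qed
qed

text \<open>Cauchy's estimate suffices whenever k! is at most the rising factorial. For k > 0 this
  fails only if n = 1 and k is 1 or 2, where the explicit coefficients take over. At k = 0 the claim
  itself breaks down: for n = 1 and b = 0 it would say 2 \<le> 1/sqrt(1 - r), false for small
  r.\<close>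

lemma abs_c_coeff_div_pochhammer_le:
  fixes l b :: "real^'n"
  assumes "0 < \<rho>" "\<And>i. \<rho> < l $ i" "0 < k"
  shows "\<bar>c_coeff l b k\<bar> / pochhammer (real CARD('n) / 2) (Suc k)
    \<le> coeff_bound l b \<rho> / ((2 * \<rho>) ^ k * fact k)"
proof (cases "fact k \<le> pochhammer (real CARD('n) / 2) (Suc k)")
  case True
  have "\<bar>c_coeff l b k\<bar> / pochhammer (real CARD('n) / 2) (Suc k)
      \<le> (coeff_bound l b \<rho> / (2 * \<rho>) ^ k) / fact k"
    by (intro frac_le abs_c_coeff_le assms True)
       (use assms(1) in \<open>auto intro!: divide_nonneg_pos coeff_bound_nonneg\<close>)
  thus ?thesis by simp
next
  case False
  have "CARD('n) = 1"
  proof (rule ccontr)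
    assume "CARD('n) \<noteq> 1"
    hence a: "1 \<le> real CARD('n) / 2" using zero_less_card_finite[where 'a='n] by linarith
    have "(fact k :: real) \<le> fact (Suc k)" by (rule fact_mono) simp
    also have "\<dots> \<le> pochhammer (real CARD('n) / 2) (Suc k)" by (rule fact_le_pochhammer[OF a])
    finally show False using False by simp
  qed
  moreover from this have "k < 3" using False fact_le_pochhammer_half[of k] by (auto simp: not_le[symmetric])
  hence "k = 1 \<or> k = 2" using assms(3) by auto
  ultimately show ?thesis
    using abs_c_coeff_div_pochhammer_le_dim_1[OF assms(1,2)] by simp
qed

lemma Gamma_add_of_nat:
  fixes a :: real
  assumes "0 < a" shows "Gamma (a + real k) = pochhammer a k * Gamma a"
proof -
  have "a \<notin> \<int>\<^sub>\<le>\<^sub>0" using assms by auto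
  thus ?thesis using Gamma_real_pos[OF assms] by (simp add: pochhammer_Gamma)
qed

section \<open>Termwise bounds and the truncation errors\<close>

text \<open>\<Gamma>(n/2+j+1) is compared with j! \<Gamma>(n/2)/2, so the factorial lags one behind
  the power of y/(2 \<rho>), and one such factor is split off.\<close>

lemma abs_pdf_term_Suc_le:
  fixes l b :: "real^'n"
  assumes "0 < \<rho>" "\<And>i. \<rho> < l $ i" "0 < y"
  shows "\<bar>pdf_term l b y (Suc j)\<bar>
    \<le> m_bound l b \<rho> / Gamma (real CARD('n) / 2) * (y / 2) powr (real CARD('n) / 2 - 1)
        * (y / (2 * \<rho>)) * ((y / (2 * \<rho>)) ^ j / fact j)"
proof -
  define a where "a = real CARD('n) / 2"
  have n: "1 \<le> real CARD('n)" using zero_less_card_finite[where 'a='n] by linarith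
  hence a: "0 < a" "1/2 \<le> a" by (auto simp: a_def)
  have G: "0 < Gamma a" using a by (intro Gamma_real_pos)
  have P: "0 < pochhammer a (Suc j)" using a by (intro pochhammer_pos)
  have "\<bar>pdf_term l b y (Suc j)\<bar>
      = \<bar>c_coeff l b (Suc j)\<bar> * (y powr (a - 1) * y ^ Suc j) / (pochhammer a (Suc j) * Gamma a)"
  proof -
    have "y powr (a + real (Suc j) - 1) = y powr (a - 1) * y ^ Suc j"
      using assms(3) by (simp add: powr_add[symmetric] powr_realpow[symmetric] algebra_simps del: power_Suc)
    thus ?thesis
      unfolding pdf_term_def a_def[symmetric] Gamma_add_of_nat[OF a(1)]
      using P G assms(3) by (simp add: abs_mult power_abs del: c_coeff.simps of_nat_Suc power_Suc)
  qed
  also have "\<dots> \<le> (coeff_bound l b \<rho> / (2 * \<rho>) ^ Suc j) * (y powr (a - 1) * y ^ Suc j)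
      / (fact j / 2 * Gamma a)"
    using fact_le_two_mult_pochhammer[OF a(2), of j] G assms(1,3)
    by (intro frac_le mult_right_mono abs_c_coeff_le assms)
       (auto intro!: mult_nonneg_nonneg divide_nonneg_nonneg coeff_bound_nonneg simp del: pochhammer_Suc)
  also have "\<dots> = (2 * 2 powr (-a) * y powr (a - 1)) * m_bound l b \<rho> / Gamma a
        * (y / (2 * \<rho>)) * ((y / (2 * \<rho>)) ^ j / fact j)"
    by (simp add: coeff_bound_def a_def power_divide power_mult_distrib mult_ac)
  \<comment> \<open>The 2 lost in the factorial comparison turns 2^(-a) into exactly the 2^(-(a-1))
    required by (y/2)^(a-1).\<close>
  also have "2 * 2 powr (-a) * y powr (a - 1) = (y / 2) powr (a - 1)"
    using assms(3) by (simp add: powr_divide powr_diff powr_minus field_simps)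
  finally show ?thesis by (simp add: a_def mult_ac)
qed

text \<open>Here 2^(-a) is used up entirely by (y/2)^a, so no constant may be lost; this is why the
  sharper \<open>abs_c_coeff_div_pochhammer_le\<close> is required.\<close>

lemma abs_cdf_term_le:
  fixes l b :: "real^'n"
  assumes "0 < \<rho>" "\<And>i. \<rho> < l $ i" "0 < y" "0 < k"
  shows "\<bar>cdf_term l b y k\<bar>
    \<le> m_bound l b \<rho> / Gamma (real CARD('n) / 2) * (y / 2) powr (real CARD('n) / 2)
        * ((y / (2 * \<rho>)) ^ k / fact k)"
proof -
  define a where "a = real CARD('n) / 2"
  have a: "0 < a" by (simp add: a_def)
  have G: "0 < Gamma a" using a by (intro Gamma_real_pos)
  have P: "0 < pochhammer a (Suc k)" using a by (intro pochhammer_pos)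
  have "\<bar>cdf_term l b y k\<bar>
      = \<bar>c_coeff l b k\<bar> / pochhammer a (Suc k) * (y powr a * y ^ k / Gamma a)"
  proof -
    have "Gamma (a + real k + 1) = pochhammer a (Suc k) * Gamma a"
      using Gamma_add_of_nat[OF a, of "Suc k"] by (simp add: add_ac)
    thus ?thesis
      unfolding cdf_term_def a_def[symmetric]
      using P G assms(3) by (simp add: abs_mult power_abs powr_add powr_realpow)
  qed
  also have "\<dots> \<le> coeff_bound l b \<rho> / ((2 * \<rho>) ^ k * fact k) * (y powr a * y ^ k / Gamma a)"
    unfolding a_def
    by (intro mult_right_mono abs_c_coeff_div_pochhammer_le assms)
       (use G assms(3) in \<open>auto simp: a_def\<close>)
  also have "\<dots> = (2 powr (-a) * y powr a) * m_bound l b \<rho> / Gamma a * ((y / (2 * \<rho>)) ^ k / fact k)"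
    by (simp add: coeff_bound_def a_def power_divide power_mult_distrib mult_ac)
  also have "2 powr (-a) * y powr a = (y / 2) powr a"
    using assms(3) by (simp add: powr_divide powr_minus field_simps)
  finally show ?thesis by (simp add: a_def mult_ac)
qed

theorem mainTheorem3:
  fixes A \<Sigma> \<Sigma>half P :: "real^'n^'n"
    and \<mu> l b :: "real^'n"
    and M :: "'a measure" and X :: "'a \<Rightarrow> real^'n"
    and \<rho> y :: real and N :: nat
  assumes "pos_def_matrix A"
    and "pos_def_matrix \<Sigma>"
    and "prob_space M"
    and "distributed M lborel X (\<lambda>x. ennreal (mvn_density \<mu> \<Sigma> x))"
    and "pos_def_matrix \<Sigma>half" and "\<Sigma>half ** \<Sigma>half = \<Sigma>"
    and "orthogonal_matrix P"
    and "transpose P ** (\<Sigma>half ** A ** \<Sigma>half) ** P = diag_matrix l"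
    and "b = transpose P *v (matrix_inv \<Sigma>half *v \<mu>)"
    and "0 < \<rho>" and "\<rho> < Min (range (\<lambda>i. l $ i))"
    and "0 < y"
  shows "summable (\<lambda>k. pdf_term l b y (k + (N + 1)))
    \<and> summable (\<lambda>k. cdf_term l b y (k + (N + 1)))
    \<and> \<bar>\<Sum>k. pdf_term l b y (k + (N + 1))\<bar>
        \<le> m_bound l b \<rho> / (Gamma (real CARD('n) / 2) * fact N)
            * (y / 2) powr (real CARD('n) / 2 - 1) * (y / (2 * \<rho>)) ^ (N + 1)
            * exp (y / (2 * \<rho>))
    \<and> \<bar>\<Sum>k. cdf_term l b y (k + (N + 1))\<bar>
        \<le> m_bound l b \<rho> / (Gamma (real CARD('n) / 2) * fact (N + 1))
            * (y / 2) powr (real CARD('n) / 2) * (y / (2 * \<rho>)) ^ (N + 1)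
            * exp (y / (2 * \<rho>))"
proof -
  have l: "\<rho> < l $ i" for i
    using \<open>\<rho> < Min (range (\<lambda>i. l $ i))\<close> by (simp add: Min_gr_iff)
  define z where "z = y / (2 * \<rho>)"
  have z: "0 \<le> z" using \<open>0 < \<rho>\<close> \<open>0 < y\<close> by (simp add: z_def)
  have m: "0 \<le> m_bound l b \<rho>" by (simp add: m_bound_def prod_nonneg)
  have G: "0 < Gamma (real CARD('n) / 2)" by (intro Gamma_real_pos) simp
  define C where "C = m_bound l b \<rho> / Gamma (real CARD('n) / 2) * (y / 2) powr (real CARD('n) / 2 - 1) * z"
  define D where "D = m_bound l b \<rho> / Gamma (real CARD('n) / 2) * (y / 2) powr (real CARD('n) / 2)"
  have CD: "0 \<le> C" "0 \<le> D" using z m G by (auto simp: C_def D_def)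
  \<comment> \<open>The density tail is majorised by the exponential tail starting at N, with the
    remaining factor z inside C; the distribution tail uses the one starting at N + 1. Hence N! in
    one bound and (N+1)! in the other, with the same power of z.\<close>
  have pdf: "\<bar>pdf_term l b y (k + (N + 1))\<bar> \<le> C * (z ^ (k + N) / fact (k + N))" for k
    using abs_pdf_term_Suc_le[OF \<open>0 < \<rho>\<close> l \<open>0 < y\<close>, of b "k + N"] by (simp add: C_def z_def)
  have cdf: "\<bar>cdf_term l b y (k + (N + 1))\<bar> \<le> D * (z ^ (k + (N + 1)) / fact (k + (N + 1)))" for k
    unfolding D_def z_def by (intro abs_cdf_term_le \<open>0 < \<rho>\<close> l \<open>0 < y\<close>) simp
  have "C * (z ^ N / fact N * exp z) = m_bound l b \<rho> / (Gamma (real CARD('n) / 2) * fact N)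
            * (y / 2) powr (real CARD('n) / 2 - 1) * z ^ (N + 1) * exp z"
    by (simp add: C_def)
  moreover have "D * (z ^ (N + 1) / fact (N + 1) * exp z)
      = m_bound l b \<rho> / (Gamma (real CARD('n) / 2) * fact (N + 1))
            * (y / 2) powr (real CARD('n) / 2) * z ^ (N + 1) * exp z"
    by (simp add: D_def del: fact_Suc)
  ultimately show ?thesis
    using abs_suminf_le_exp_tail[OF z CD(1) pdf] abs_suminf_le_exp_tail[OF z CD(2) cdf]
    unfolding z_def by simp
qed

end
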